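(* Let $Q$ be a quiver that has a finite forkless part, and let $M$ be the number of non-forks in the labelled mutation class of $Q$. Let $Q'$ be any (possibly disconnected) full subquiver of $Q$, and let $m$ be the number of vertices of $Q'$. Then $Q'$ also has a finite forkless part, and the number of non-forks in the labelled mutation class of $Q'$ is at most $\max\{M,m\}$.
   Context: A quiver is a finite directed multigraph with vertex set $Q_0$ and arrow set $Q_1$, with no loops and no 2-cycles (so all arrows between two vertices point the same way). For vertices $i,j$ write $q_{ij}$ for the number of arrows $i\to j$ if there are such arrows, and minus the number of arrows $j\to i$ otherwise. Mutation at a vertex $v$ produces $\mu_v(Q)$ with $q'_{ab}=-q_{ab}$ if $v\in\{a,b\}$ and $q'_{ab}=q_{ab}+\max(q_{av},0)\max(q_{vb},0)-\max(q_{bv},0)\max(q_{va},0)$ otherwise. The labelled mutation class $[Q]$ is the set of quivers on the vertex set $Q_0$ obtainable from $Q$ by finite sequences of mutations (quivers are compared as labelled quivers). A full subquiver is the quiver induced on a subset of the vertices, containing all arrows between them. A quiver is abundant if there are at least two arrows between every pair of distinct vertices, and acyclic if it has no directed cycle. $Q^+(v)=\{j: q_{vj}>0\}$, $Q^-(v)=\{j:q_{jv}>0\}$. A fork is an abundant quiver $F$ that is not acyclic and has a vertex $r$ (point of return) such that (i) for all $i\in F^-(r)$ and $j\in F^+(r)$ we have $f_{ji}>f_{ir}$ and $f_{ji}>f_{rj}$, and (ii) the full subquivers induced by $F^-(r)$ and by $F^+(r)$ are acyclic. A non-fork is a quiver that is not a fork. The forkless part of $Q$ is the set of non-forks in $[Q]$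 (with the induced subgraph of the labelled mutation graph); $Q$ has a finite forkless part if this set is finite. *)

theory Defs
  imports Main
begin

text \<open>A multigraph is recorded by its arrow multiplicities: \<open>arrows Q i j\<close> is the number of arrows
  from \<open>i\<close> to \<open>j\<close>. Since \<open>quiver\<close> forces multiplicities to vanish off the vertex set, equality of
  the records is equality of labelled quivers.\<close>

record 'a pre_quiver =
  verts :: "'a set"
  arrows :: "'a \<Rightarrow> 'a \<Rightarrow> nat"

definition quiver :: "'a pre_quiver \<Rightarrow> bool" where
  "quiver Q \<longleftrightarrow>
     finite (verts Q) \<and>
     (\<forall>i j. arrows Q i j > 0 \<longrightarrow> i \<in> verts Q \<and> j \<in> verts Q) \<and>
     (\<forall>i. arrows Q i i = 0) \<and>
     (\<forall>i j. arrows Q i j = 0 \<or> arrows Q j i = 0)"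

definition sarrows :: "'a pre_quiver \<Rightarrow> 'a \<Rightarrow> 'a \<Rightarrow> int" where
  "sarrows Q i j = (if arrows Q i j > 0 then int (arrows Q i j) else - int (arrows Q j i))"

definition mutated_sarrows :: "'a \<Rightarrow> 'a pre_quiver \<Rightarrow> 'a \<Rightarrow> 'a \<Rightarrow> int" where
  "mutated_sarrows v Q a b =
     (if v \<in> {a, b} then - sarrows Q a b
      else sarrows Q a b
           + max (sarrows Q a v) 0 * max (sarrows Q v b) 0
           - max (sarrows Q b v) 0 * max (sarrows Q v a) 0)"

text \<open>The number of arrows \<open>a \<rightarrow> b\<close> is the positive part of the signed count; see
  \<open>sarrows_mutate\<close> below.\<close>

definition mutate :: "'a \<Rightarrow> 'a pre_quiver \<Rightarrow> 'a pre_quiver" where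
  "mutate v Q = \<lparr>verts = verts Q, arrows = (\<lambda>a b. nat (mutated_sarrows v Q a b))\<rparr>"

inductive_set mutation_class :: "'a pre_quiver \<Rightarrow> 'a pre_quiver set" for Q where
  base: "Q \<in> mutation_class Q"
| step: "R \<in> mutation_class Q \<Longrightarrow> v \<in> verts R \<Longrightarrow> mutate v R \<in> mutation_class Q"

definition full_subquiver :: "'a pre_quiver \<Rightarrow> 'a set \<Rightarrow> 'a pre_quiver" where
  "full_subquiver Q S =
     \<lparr>verts = S, arrows = (\<lambda>i j. if i \<in> S \<and> j \<in> S then arrows Q i j else 0)\<rparr>"

definition abundant :: "'a pre_quiver \<Rightarrow> bool" where
  "abundant Q \<longleftrightarrow> (\<forall>i \<in> verts Q. \<forall>j \<in> verts Q. i \<noteq> j \<longrightarrow> \<bar>sarrows Q i j\<bar> \<ge> 2)"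

definition acyclic_quiver :: "'a pre_quiver \<Rightarrow> bool" where
  "acyclic_quiver Q \<longleftrightarrow> acyclic {(i, j). arrows Q i j > 0}"

definition out_nbrs :: "'a pre_quiver \<Rightarrow> 'a \<Rightarrow> 'a set" where
  "out_nbrs Q v = {j \<in> verts Q. sarrows Q v j > 0}"

definition in_nbrs :: "'a pre_quiver \<Rightarrow> 'a \<Rightarrow> 'a set" where
  "in_nbrs Q v = {j \<in> verts Q. sarrows Q j v > 0}"

definition point_of_return :: "'a pre_quiver \<Rightarrow> 'a \<Rightarrow> bool" where
  "point_of_return F r \<longleftrightarrow>
     r \<in> verts F \<and>
     (\<forall>i \<in> in_nbrs F r. \<forall>j \<in> out_nbrs F r.
        sarrows F j i > sarrows F i r \<and> sarrows F j i > sarrows F r j) \<and>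
     acyclic_quiver (full_subquiver F (in_nbrs F r)) \<and>
     acyclic_quiver (full_subquiver F (out_nbrs F r))"

definition fork :: "'a pre_quiver \<Rightarrow> bool" where
  "fork F \<longleftrightarrow> abundant F \<and> \<not> acyclic_quiver F \<and> (\<exists>r. point_of_return F r)"

definition forkless_part :: "'a pre_quiver \<Rightarrow> 'a pre_quiver set" where
  "forkless_part Q = {R \<in> mutation_class Q. \<not> fork R}"

lemma sarrows_antisym: "quiver Q \<Longrightarrow> sarrows Q j i = - sarrows Q i j"
proof -
  assume "quiver Q"
  then have "arrows Q i j = 0 \<or> arrows Q j i = 0" unfolding quiver_def by simp
  then show ?thesis by (auto simp: sarrows_def)
qed

lemma mutated_sarrows_antisym:
  "quiver Q \<Longrightarrow> mutated_sarrows v Q b a = - mutated_sarrows v Q a b"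
  unfolding mutated_sarrows_def by (simp add: sarrows_antisym[of Q a b] insert_commute)

lemma sarrows_mutate: "quiver Q \<Longrightarrow> sarrows (mutate v Q) a b = mutated_sarrows v Q a b"
  using mutated_sarrows_antisym[of Q v a b] by (auto simp: sarrows_def mutate_def)

lemma sarrows_outside:
  assumes "quiver Q" and "a \<notin> verts Q \<or> b \<notin> verts Q"
  shows "sarrows Q a b = 0"
proof -
  have "arrows Q a b = 0" "arrows Q b a = 0"
    using assms unfolding quiver_def by blast+
  then show ?thesis by (simp add: sarrows_def)
qed

lemma quiver_mutate:
  assumes Q: "quiver Q" and v: "v \<in> verts Q"
  shows "quiver (mutate v Q)"
proof -
  have "finite (verts Q)" using Q by (simp add: quiver_def)
  moreover have "mutated_sarrows v Q a b = 0" if "a \<notin> verts Q \<or> b \<notin> verts Q" for a b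
    using that sarrows_outside[OF Q] unfolding mutated_sarrows_def by auto
  then have "a \<in> verts Q \<and> b \<in> verts Q" if "mutated_sarrows v Q a b > 0" for a b
    using that by (metis less_irrefl)
  moreover have "mutated_sarrows v Q a a = 0" for a
    using mutated_sarrows_antisym[OF Q, of v a a] by simp
  moreover have "mutated_sarrows v Q a b \<le> 0 \<or> mutated_sarrows v Q b a \<le> 0" for a b
    using mutated_sarrows_antisym[OF Q, of v a b] by linarith
  ultimately show ?thesis by (simp add: quiver_def mutate_def)
qed

lemma quiver_full_subquiver:
  "quiver Q \<Longrightarrow> S \<subseteq> verts Q \<Longrightarrow> quiver (full_subquiver Q S)"
  by (auto simp: quiver_def full_subquiver_def intro: finite_subset split: if_splits)

end

(* Restriction to S commutes with mutation at vertices of S, so every quiver in [Q|S] lifts to [Q].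
   A full subquiver of a fork is a fork or abundant acyclic.  If [Q|S] contains no abundant acyclic
   quiver, all lifts of non-forks are therefore non-forks, and restriction gives the bound M.
   If [Q|S] contains an abundant acyclic quiver P, then mutating at a source or sink rotates the
   linear order underlying P, which yields at most m quivers, and any other mutation produces a fork
   whose point of return is the mutated vertex.  Mutating a fork away from its point of return again
   gives such a fork, so a non-fork is only reached by undoing all those steps. *)

theory Submission
  imports Defs
begin

section \<open>Quivers and restriction\<close>

text \<open>Multiplicities are the positive parts of signed counts, so equalities of quivers can be
  checked on \<open>sarrows\<close>, the language of the mutation formula.\<close>

lemma quiver_eqI:
  assumes "quiver A" "quiver B" "verts A = verts B" "\<And>i j. sarrows A i j = sarrows B i j"
  shows "A = B"
proof -
  have "arrows R i j = nat (sarrows R i j)" for R :: "'a pre_quiver" and i j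
    by (simp add: sarrows_def)
  then have "arrows A = arrows B" using assms(4) by (intro ext) simp
  then show ?thesis using assms(3) by (cases A, cases B) simp
qed

lemma sarrows_refl: "quiver Q \<Longrightarrow> sarrows Q a a = 0"
  by (auto simp: quiver_def sarrows_def)

lemma sarrows_pos_verts: "quiver Q \<Longrightarrow> sarrows Q a b > 0 \<Longrightarrow> a \<in> verts Q \<and> b \<in> verts Q"
  using sarrows_outside[of Q a b] by fastforce

lemma arrows_pos_iff: "arrows Q a b > 0 \<longleftrightarrow> sarrows Q a b > 0"
  by (simp add: sarrows_def)

lemma verts_mutate [simp]: "verts (mutate v Q) = verts Q"
  by (simp add: mutate_def)

lemma verts_full_subquiver [simp]: "verts (full_subquiver Q S) = S"
  by (simp add: full_subquiver_def)

lemma sarrows_full_subquiver: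
  "sarrows (full_subquiver Q S) i j = (if i \<in> S \<and> j \<in> S then sarrows Q i j else 0)"
  by (auto simp: sarrows_def full_subquiver_def)

text \<open>The correction at a, b reads only arrows at v. The first mutation reverses these, so the
  second correction is the negative of the first.\<close>

lemma mutate_mutate:
  assumes Q: "quiver Q" and v: "v \<in> verts Q"
  shows "mutate v (mutate v Q) = Q"
proof (rule quiver_eqI)
  have M: "quiver (mutate v Q)" by (rule quiver_mutate[OF Q v])
  show "quiver (mutate v (mutate v Q))" using quiver_mutate[OF M] v by simp
  show "sarrows (mutate v (mutate v Q)) i j = sarrows Q i j" for i j
    unfolding sarrows_mutate[OF M] mutated_sarrows_def[of v "mutate v Q"] sarrows_mutate[OF Q]
    unfolding mutated_sarrows_def
    using sarrows_antisym[OF Q, of v i] sarrows_antisym[OF Q, of v j] by simp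
qed (use Q in auto)

text \<open>The new count between a and b depends only on arrows among a, b and v; with all three in
  S, nothing outside S contributes.\<close>

lemma full_subquiver_mutate:
  assumes Q: "quiver Q" and S: "S \<subseteq> verts Q" and v: "v \<in> S"
  shows "full_subquiver (mutate v Q) S = mutate v (full_subquiver Q S)"
proof (rule quiver_eqI)
  have QS: "quiver (full_subquiver Q S)" by (rule quiver_full_subquiver[OF Q S])
  have M: "quiver (mutate v Q)" using quiver_mutate[OF Q] S v by auto
  show "quiver (full_subquiver (mutate v Q) S)" using quiver_full_subquiver[OF M] S by simp
  show "quiver (mutate v (full_subquiver Q S))" using quiver_mutate[OF QS] v by simp
  show "sarrows (full_subquiver (mutate v Q) S) i j = sarrows (mutate v (full_subquiver Q S)) i j" for i j
    using v by (auto simp: sarrows_full_subquiver sarrows_mutate Q QS mutated_sarrows_def)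
qed auto

section \<open>Mutation classes and their restrictions\<close>

lemma quiver_mutation_class:
  assumes "R \<in> mutation_class Q" and "quiver Q"
  shows "quiver R \<and> verts R = verts Q"
  using assms by induction (auto simp: quiver_mutate)

lemma mutation_class_trans:
  assumes "R \<in> mutation_class P" and "P \<in> mutation_class Q"
  shows "R \<in> mutation_class Q"
  using assms by induction (auto intro: mutation_class.intros)

lemma mutation_class_sym:
  assumes "R \<in> mutation_class Q" and "quiver Q"
  shows "Q \<in> mutation_class R"
  using assms
proof induction
  case base
  show ?case by (rule mutation_class.base)
next
  case (step R v)
  have "quiver R" using quiver_mutation_class[OF step.hyps(1) step.prems] by simp
  then have "R \<in> mutation_class (mutate v R)"
    using mutation_class.step[OF mutation_class.base, of v "mutate v R"] step.hyps(2)
    by (simp add: mutate_mutate)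
  then show ?case using mutation_class_trans[OF step.IH[OF step.prems]] by blast
qed

text \<open>The lift L is obtained by performing the same mutation sequence in Q.\<close>

lemma mutation_class_full_subquiver_lift:
  assumes "R \<in> mutation_class (full_subquiver Q S)" and "quiver Q" and "S \<subseteq> verts Q"
  shows "\<exists>L \<in> mutation_class Q. full_subquiver L S = R"
  using assms
proof induction
  case base
  show ?case using mutation_class.base by blast
next
  case (step R v)
  then obtain L where L: "L \<in> mutation_class Q" "full_subquiver L S = R" by blast
  then have "quiver L" "verts L = verts Q" using quiver_mutation_class step.prems by auto
  moreover have "v \<in> S" using step.hyps(2) L(2) by auto
  ultimately show ?case
    using full_subquiver_mutate[of L S v] L step.prems mutation_class.step[OF L(1), of v] by blast
qed

section \<open>Abundant quivers\<close>

lemma abundant_cases: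
  assumes "quiver Q" "abundant Q" "a \<in> verts Q" "b \<in> verts Q"
  obtains "a = b" | "a \<noteq> b" "sarrows Q a b \<ge> 2" "sarrows Q b a = - sarrows Q a b"
    | "a \<noteq> b" "sarrows Q b a \<ge> 2" "sarrows Q a b = - sarrows Q b a"
proof -
  have "a \<noteq> b \<longrightarrow> \<bar>sarrows Q a b\<bar> \<ge> 2" using assms unfolding abundant_def by blast
  moreover have "sarrows Q b a = - sarrows Q a b" by (rule sarrows_antisym[OF assms(1)])
  ultimately show thesis using that by linarith
qed

lemma abundant_pos_ge_2:
  assumes "quiver Q" "abundant Q" "sarrows Q a b > 0"
  shows "sarrows Q a b \<ge> 2"
proof -
  have "a \<in> verts Q" "b \<in> verts Q" using sarrows_pos_verts[OF assms(1,3)] by auto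
  moreover have "a \<noteq> b" using sarrows_refl[OF assms(1)] assms(3) by auto
  ultimately have "\<bar>sarrows Q a b\<bar> \<ge> 2" using assms(2) unfolding abundant_def by blast
  then show ?thesis using assms(3) by linarith
qed

text \<open>Forgetting multiplicities, an abundant quiver is a tournament, and a tournament has no
  directed cycle exactly when it is transitive. Acyclicity thus becomes a condition on
  triples.\<close>

lemma acyclic_full_subquiver_iff:
  assumes Q: "quiver Q" and ab: "abundant Q" and T: "T \<subseteq> verts Q"
  shows "acyclic_quiver (full_subquiver Q T) \<longleftrightarrow> transp_on T (\<lambda>a b. sarrows Q a b > 0)"
proof -
  define E where "E = {(i, j). arrows (full_subquiver Q T) i j > 0}"
  have E: "(i, j) \<in> E \<longleftrightarrow> i \<in> T \<and> j \<in> T \<and> sarrows Q i j > 0" for i j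
    unfolding E_def by (auto simp: arrows_pos_iff sarrows_full_subquiver)
  have "acyclic E \<longleftrightarrow> transp_on T (\<lambda>a b. sarrows Q a b > 0)"
  proof
    assume ac: "acyclic E"
    show "transp_on T (\<lambda>a b. sarrows Q a b > 0)"
    proof (rule transp_onI)
      fix a b c assume T': "a \<in> T" "b \<in> T" "c \<in> T" and p: "sarrows Q a b > 0" "sarrows Q b c > 0"
      have path: "(a, c) \<in> E\<^sup>+" using T' p E by (meson trancl.simps)
      then have "a \<noteq> c" using ac by (auto simp: acyclic_def)
      have "(c, a) \<notin> E"
      proof
        assume "(c, a) \<in> E"
        then have "(a, a) \<in> E\<^sup>+" using path by (rule trancl_into_trancl[rotated])
        then show False using ac by (auto simp: acyclic_def)
      qed
      then have "\<not> sarrows Q c a > 0" using E T' by simp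
      moreover have "a \<in> verts Q" "c \<in> verts Q" using T T' by auto
      ultimately show "sarrows Q a c > 0"
        using \<open>a \<noteq> c\<close> abundant_cases[OF Q ab, of a c] by force
    qed
  next
    assume "transp_on T (\<lambda>a b. sarrows Q a b > 0)"
    then have "trans E" unfolding trans_def E by (meson transp_onD)
    moreover have "(x, x) \<notin> E" for x using E sarrows_refl[OF Q] by simp
    ultimately show "acyclic E" by (simp add: acyclic_def)
  qed
  then show ?thesis by (simp add: acyclic_quiver_def E_def)
qed

lemma full_subquiver_verts:
  assumes "quiver Q"
  shows "full_subquiver Q (verts Q) = Q"
  by (rule quiver_eqI)
    (use assms in \<open>auto simp: quiver_full_subquiver sarrows_full_subquiver sarrows_outside\<close>)

lemma acyclic_quiver_iff:
  assumes "quiver Q" "abundant Q"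
  shows "acyclic_quiver Q \<longleftrightarrow> transp_on (verts Q) (\<lambda>a b. sarrows Q a b > 0)"
  using acyclic_full_subquiver_iff[OF assms order_refl] full_subquiver_verts[OF assms(1)] by simp

lemma abundant_full_subquiver: "abundant Q \<Longrightarrow> S \<subseteq> verts Q \<Longrightarrow> abundant (full_subquiver Q S)"
  by (auto simp: abundant_def sarrows_full_subquiver)

lemma full_subquiver_full_subquiver:
  "T \<subseteq> S \<Longrightarrow> full_subquiver (full_subquiver Q S) T = full_subquiver Q T"
  by (auto simp: full_subquiver_def fun_eq_iff)

lemma acyclic_full_subquiver_mono:
  assumes "acyclic_quiver (full_subquiver Q T)" and "U \<subseteq> T"
  shows "acyclic_quiver (full_subquiver Q U)"
  using assms unfolding acyclic_quiver_def
  by (elim acyclic_subset) (auto simp: full_subquiver_def)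

lemma in_nbrs_subset: "in_nbrs Q v \<subseteq> verts Q" and out_nbrs_subset: "out_nbrs Q v \<subseteq> verts Q"
  by (auto simp: in_nbrs_def out_nbrs_def)

lemma verts_eq_nbrs:
  assumes "quiver Q" "abundant Q" "r \<in> verts Q" "x \<in> verts Q" "x \<noteq> r"
  shows "x \<in> in_nbrs Q r \<or> x \<in> out_nbrs Q r"
  by (rule abundant_cases[OF assms(1-4)])
    (use assms(4,5) in \<open>auto simp: in_nbrs_def out_nbrs_def\<close>)

section \<open>Forks\<close>

text \<open>Every arrow between the two neighbourhoods of a point of return runs from \<open>out_nbrs\<close> to
  \<open>in_nbrs\<close>.\<close>

lemma point_of_return_transp_on:
  assumes Q: "quiver Q" and ab: "abundant Q" and r: "point_of_return Q r"
  shows "transp_on (verts Q - {r}) (\<lambda>a b. sarrows Q a b > 0)"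
proof (rule transp_onI)
  fix a b c
  assume V: "a \<in> verts Q - {r}" "b \<in> verts Q - {r}" "c \<in> verts Q - {r}"
    and p: "sarrows Q a b > 0" "sarrows Q b c > 0"
  let ?I = "in_nbrs Q r" and ?O = "out_nbrs Q r"
  have rV: "r \<in> verts Q" using r by (simp add: point_of_return_def)
  have I: "transp_on ?I (\<lambda>a b. sarrows Q a b > 0)" and O: "transp_on ?O (\<lambda>a b. sarrows Q a b > 0)"
    using r acyclic_full_subquiver_iff[OF Q ab in_nbrs_subset]
      acyclic_full_subquiver_iff[OF Q ab out_nbrs_subset]
    by (auto simp: point_of_return_def)
  have OI: "sarrows Q j i > 0" if "i \<in> ?I" "j \<in> ?O" for i j
    using r that by (force simp: point_of_return_def in_nbrs_def)
  have IO: "\<not> sarrows Q i j > 0" if "i \<in> ?I" "j \<in> ?O" for i j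
    using OI[OF that] sarrows_antisym[OF Q, of i j] by simp
  have "x \<in> ?I \<or> x \<in> ?O" if "x \<in> {a, b, c}" for x
    using verts_eq_nbrs[OF Q ab rV, of x] V that by auto
  then consider "a \<in> ?I" "b \<in> ?I" "c \<in> ?I" | "a \<in> ?O" "c \<in> ?I" | "a \<in> ?O" "b \<in> ?O" "c \<in> ?O"
    using IO p by blast
  then show "sarrows Q a c > 0"
  proof cases
    case 1
    then show ?thesis using I p by (meson transp_onD)
  next
    case 2
    then show ?thesis using OI by simp
  next
    case 3
    then show ?thesis using O p by (meson transp_onD)
  qed
qed

text \<open>If r survives in S, it keeps the properties of a point of return, and only acyclicity
  decides between the two alternatives. If r is deleted, what remains is transitive.\<close>

lemma full_subquiver_fork:
  assumes Q: "quiver Q" and f: "fork Q" and S: "S \<subseteq> verts Q"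
  shows "fork (full_subquiver Q S) \<or>
    abundant (full_subquiver Q S) \<and> acyclic_quiver (full_subquiver Q S)"
proof -
  let ?R = "full_subquiver Q S"
  obtain r where ab: "abundant Q" and r: "point_of_return Q r" using f by (auto simp: fork_def)
  have abR: "abundant ?R" by (rule abundant_full_subquiver[OF ab S])
  show ?thesis
  proof (cases "r \<in> S")
    case True
    have I: "in_nbrs ?R r = in_nbrs Q r \<inter> S" and O: "out_nbrs ?R r = out_nbrs Q r \<inter> S"
      using True S by (auto simp: in_nbrs_def out_nbrs_def sarrows_full_subquiver)
    have "point_of_return ?R r"
      unfolding point_of_return_def I O
      using r True by (auto simp: point_of_return_def sarrows_full_subquiver
          full_subquiver_full_subquiver intro: acyclic_full_subquiver_mono)
    then show ?thesis using abR by (auto simp: fork_def)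
  next
    case False
    then have "transp_on S (\<lambda>a b. sarrows Q a b > 0)"
      using transp_on_subset[OF point_of_return_transp_on[OF Q ab r]] S by blast
    then show ?thesis using abR acyclic_full_subquiver_iff[OF Q ab S] by simp
  qed
qed

text \<open>A fork with its point of return recorded. Nonempty neighbourhoods replace
  non-acyclicity: they yield a directed triangle i -> r -> j -> i.\<close>

definition fork_at :: "'a pre_quiver \<Rightarrow> 'a \<Rightarrow> bool" where
  "fork_at F r \<longleftrightarrow>
     abundant F \<and> point_of_return F r \<and> in_nbrs F r \<noteq> {} \<and> out_nbrs F r \<noteq> {}"

lemma fork_at_imp_fork:
  assumes Q: "quiver F" and f: "fork_at F r"
  shows "fork F"
proof -
  obtain i j where ij: "i \<in> in_nbrs F r" "j \<in> out_nbrs F r"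
    and ab: "abundant F" and r: "point_of_return F r" using f by (auto simp: fork_at_def)
  have "\<not> acyclic_quiver F"
  proof
    assume "acyclic_quiver F"
    then have "transp_on (verts F) (\<lambda>a b. sarrows F a b > 0)"
      using acyclic_quiver_iff[OF Q ab] by simp
    moreover have "i \<in> verts F" "j \<in> verts F" "r \<in> verts F" "sarrows F i r > 0" "sarrows F r j > 0"
      using ij r by (auto simp: in_nbrs_def out_nbrs_def point_of_return_def)
    ultimately have "sarrows F i j > 0" by (meson transp_onD)
    moreover have "sarrows F j i > 0" using r ij by (force simp: point_of_return_def in_nbrs_def)
    ultimately show False using sarrows_antisym[OF Q, of i j] by simp
  qed
  then show ?thesis using ab r by (auto simp: fork_def)
qed

text \<open>Mutation at v swaps the two neighbourhoods of v, keeps the arrows inside each, and adds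
  the product \<open>sarrows Q j v * sarrows Q v i\<close> to the count from j to i. Hence
  \<open>gt\<close> is the point-of-return inequality of the mutated quiver.\<close>

lemma fork_at_mutateI:
  assumes Q: "quiver Q" and ab: "abundant Q" and v: "v \<in> verts Q"
    and ne: "in_nbrs Q v \<noteq> {}" "out_nbrs Q v \<noteq> {}"
    and I: "transp_on (in_nbrs Q v) (\<lambda>a b. sarrows Q a b > 0)"
    and O: "transp_on (out_nbrs Q v) (\<lambda>a b. sarrows Q a b > 0)"
    and gt: "\<And>i j. sarrows Q j v > 0 \<Longrightarrow> sarrows Q v i > 0 \<Longrightarrow>
      sarrows Q j i + sarrows Q j v * sarrows Q v i > sarrows Q j v \<and>
      sarrows Q j i + sarrows Q j v * sarrows Q v i > sarrows Q v i"
  shows "fork_at (mutate v Q) v"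
proof -
  let ?M = "mutate v Q"
  note anti = sarrows_antisym[OF Q]
  have M: "quiver ?M" by (rule quiver_mutate[OF Q v])
  have nI: "in_nbrs ?M v = out_nbrs Q v" and nO: "out_nbrs ?M v = in_nbrs Q v"
    using anti[of v] by (auto simp: in_nbrs_def out_nbrs_def sarrows_mutate[OF Q] mutated_sarrows_def)
  have sv: "sarrows ?M a v = sarrows Q v a" "sarrows ?M v a = sarrows Q a v" for a
    using anti[of v a] by (auto simp: sarrows_mutate[OF Q] mutated_sarrows_def)
  have mixed: "sarrows ?M j i = sarrows Q j i + sarrows Q j v * sarrows Q v i"
    if "sarrows Q j v > 0" "sarrows Q v i > 0" for i j
  proof -
    have "i \<noteq> v" "j \<noteq> v" using that sarrows_refl[OF Q] by auto
    then show ?thesis using that anti[of v i] anti[of v j]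
      by (simp add: sarrows_mutate[OF Q] mutated_sarrows_def)
  qed
  have same: "sarrows ?M a b = sarrows Q a b"
    if "sarrows Q a v > 0 \<and> sarrows Q b v > 0 \<or> sarrows Q v a > 0 \<and> sarrows Q v b > 0" for a b
  proof -
    have "a \<noteq> v" "b \<noteq> v" using that sarrows_refl[OF Q] by auto
    then show ?thesis using that anti[of v a] anti[of v b]
      by (auto simp: sarrows_mutate[OF Q] mutated_sarrows_def)
  qed
  have abM: "abundant ?M"
    unfolding abundant_def
  proof (intro ballI impI)
    fix a b assume "a \<in> verts ?M" "b \<in> verts ?M" and neq: "a \<noteq> b"
    then have V: "a \<in> verts Q" "b \<in> verts Q" by auto
    then have q: "\<bar>sarrows Q a b\<bar> \<ge> 2" using ab neq by (auto simp: abundant_def)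
    have q': "sarrows Q a v > 0 \<or> sarrows Q v a > 0" if "a \<noteq> v" "a \<in> verts Q" for a
      using verts_eq_nbrs[OF Q ab v that(2,1)] by (auto simp: in_nbrs_def out_nbrs_def)
    \<comment> \<open>The same inequality gives abundance across the two neighbourhoods: the new
      count exceeds one that is already at least 2.\<close>
    have cross: "sarrows ?M j i \<ge> 2" if "sarrows Q j v > 0" "sarrows Q v i > 0" for i j
      using gt[OF that] mixed[OF that] abundant_pos_ge_2[OF Q ab that(1)] by linarith
    show "\<bar>sarrows ?M a b\<bar> \<ge> 2"
    proof (cases "v \<in> {a, b}")
      case True
      then show ?thesis using q by (auto simp: sarrows_mutate[OF Q] mutated_sarrows_def)
    next
      case False
      then have "sarrows Q a v > 0 \<or> sarrows Q v a > 0" "sarrows Q b v > 0 \<or> sarrows Q v b > 0"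
        using q'[of a] q'[of b] V by auto
      then show ?thesis
        using same[of a b] q cross[of a b] cross[of b a] sarrows_antisym[OF M, of a b] by auto
    qed
  qed
  have "transp_on T (\<lambda>a b. sarrows ?M a b > 0)"
    if T: "transp_on T (\<lambda>a b. sarrows Q a b > 0)" "T = in_nbrs Q v \<or> T = out_nbrs Q v" for T
  proof (rule transp_onI)
    fix a b c assume abc: "a \<in> T" "b \<in> T" "c \<in> T"
      and p: "sarrows ?M a b > 0" "sarrows ?M b c > 0"
    have "sarrows ?M x y = sarrows Q x y" if "x \<in> T" "y \<in> T" for x y
      using same[of x y] T(2) that by (auto simp: in_nbrs_def out_nbrs_def)
    then show "sarrows ?M a c > 0" using transp_onD[OF T(1) abc] abc p by simp
  qed
  then have "transp_on (out_nbrs Q v) (\<lambda>a b. sarrows ?M a b > 0)"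
    "transp_on (in_nbrs Q v) (\<lambda>a b. sarrows ?M a b > 0)"
    using I O by blast+
  then have "acyclic_quiver (full_subquiver ?M (in_nbrs ?M v))"
    "acyclic_quiver (full_subquiver ?M (out_nbrs ?M v))"
    using acyclic_full_subquiver_iff[OF M abM in_nbrs_subset, of v]
      acyclic_full_subquiver_iff[OF M abM out_nbrs_subset, of v] nI nO by simp_all
  moreover have "sarrows ?M j i > sarrows ?M i v \<and> sarrows ?M j i > sarrows ?M v j"
    if "i \<in> in_nbrs ?M v" "j \<in> out_nbrs ?M v" for i j
    using that gt[of j i] mixed[of j i] unfolding nI nO sv by (simp add: in_nbrs_def out_nbrs_def)
  ultimately have "point_of_return ?M v" using v by (auto simp: point_of_return_def)
  then show ?thesis using abM ne nI nO by (simp add: fork_at_def)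
qed

lemma add_mult_gt:
  fixes x y z :: int
  assumes "x \<ge> 2" "y \<ge> 2" "z > 0"
  shows "z + x * y > x \<and> z + x * y > y"
proof -
  have "x * y \<ge> x * 1" "x * y \<ge> 1 * y" using assms by (intro mult_mono; simp)+
  then show ?thesis using assms by linarith
qed

text \<open>For the case where z existing arrows oppose the x * y new ones: y at least 2 gives x * y
  - z \<ge> 2 * x - z > x > y.\<close>

lemma diff_mult_gt:
  fixes x y z :: int
  assumes "x > z" "x > y" "y \<ge> 2"
  shows "x * y - z > x \<and> x * y - z > y"
proof -
  have "x * y \<ge> x * 2" using assms by (intro mult_left_mono) auto
  then show ?thesis using assms by linarith
qed

text \<open>By transitivity j -> v -> i forces j -> i, so the new arrows only reinforce existing
  ones.\<close>

lemma fork_at_mutate_acyclic: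
  assumes Q: "quiver Q" and ab: "abundant Q" and ac: "acyclic_quiver Q" and v: "v \<in> verts Q"
    and ne: "in_nbrs Q v \<noteq> {}" "out_nbrs Q v \<noteq> {}"
  shows "fork_at (mutate v Q) v"
proof (rule fork_at_mutateI[OF Q ab v ne])
  have tr: "transp_on (verts Q) (\<lambda>a b. sarrows Q a b > 0)"
    using acyclic_quiver_iff[OF Q ab] ac by simp
  then show "transp_on (in_nbrs Q v) (\<lambda>a b. sarrows Q a b > 0)"
    "transp_on (out_nbrs Q v) (\<lambda>a b. sarrows Q a b > 0)"
    using transp_on_subset in_nbrs_subset out_nbrs_subset by metis+
  fix i j assume p: "sarrows Q j v > 0" "sarrows Q v i > 0"
  then have "sarrows Q j i > 0"
    using tr sarrows_pos_verts[OF Q] by (meson transp_onD)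
  then show "sarrows Q j i + sarrows Q j v * sarrows Q v i > sarrows Q j v \<and>
      sarrows Q j i + sarrows Q j v * sarrows Q v i > sarrows Q v i"
    using add_mult_gt p abundant_pos_ge_2[OF Q ab] by presburger
qed

text \<open>Away from r the quiver is transitive and the acyclic argument applies. New arrows can
  meet opposing ones only in a triangle through r and v, and there the inequality at r makes the
  product win.\<close>

lemma fork_at_mutate_fork_at:
  assumes Q: "quiver Q" and f: "fork_at Q r" and v: "v \<in> verts Q" and vr: "v \<noteq> r"
  shows "fork_at (mutate v Q) v"
proof -
  let ?I = "in_nbrs Q r" and ?O = "out_nbrs Q r" and ?lt = "\<lambda>a b. sarrows Q a b > 0"
  have ab: "abundant Q" and r: "point_of_return Q r" and ne: "?I \<noteq> {}" "?O \<noteq> {}"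
    using f by (auto simp: fork_at_def)
  note anti = sarrows_antisym[OF Q]
  note ge2 = abundant_pos_ge_2[OF Q ab]
  have rV: "r \<in> verts Q" using r by (simp add: point_of_return_def)
  have trr: "transp_on (verts Q - {r}) ?lt"
    by (rule point_of_return_transp_on[OF Q ab r])
  have gt: "sarrows Q j i > sarrows Q i r" "sarrows Q j i > sarrows Q r j"
    if "sarrows Q i r > 0" "sarrows Q r j > 0" for i j
    using r that sarrows_pos_verts[OF Q] by (auto simp: point_of_return_def in_nbrs_def out_nbrs_def)
  have nr: "sarrows Q x r > 0 \<or> sarrows Q r x > 0" if "x \<in> verts Q" "x \<noteq> r" for x
    using verts_eq_nbrs[OF Q ab rV that] by (auto simp: in_nbrs_def out_nbrs_def)
  have rest: "transp_on T ?lt" if "T \<subseteq> verts Q" "r \<notin> T" for T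
    using trr that by (auto intro: transp_on_subset)
  obtain i0 j0 where i0: "sarrows Q i0 r > 0" and j0: "sarrows Q r j0 > 0"
    using ne by (auto simp: in_nbrs_def out_nbrs_def)
  have concl: "sarrows Q j i + sarrows Q j v * sarrows Q v i > sarrows Q j v \<and>
      sarrows Q j i + sarrows Q j v * sarrows Q v i > sarrows Q v i"
    if "sarrows Q j v > 0" "sarrows Q v i > 0" "sarrows Q j i > 0" for i j
    using add_mult_gt that ge2 by presburger
  have off: "sarrows Q j i > 0" if "sarrows Q j v > 0" "sarrows Q v i > 0" "i \<noteq> r" "j \<noteq> r" for i j
    using transp_onD[OF trr, of j v i] that vr sarrows_pos_verts[OF Q] by auto
  consider (src) "sarrows Q v r > 0" | (tgt) "sarrows Q r v > 0" using nr v vr by blast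
  then show ?thesis
  proof cases
    case src
    have jr: "j \<noteq> r" if "sarrows Q j v > 0" for j
      using src anti[of v r] that by auto
    \<comment> \<open>An arrow r -> i would force i -> v by the inequality at r. So r is a sink
      among the out-neighbours of v.\<close>
    have ir: "i = r \<or> sarrows Q i r > 0" if "sarrows Q v i > 0" for i
      using gt[OF src, of i] src anti[of v i] that nr[of i] sarrows_pos_verts[OF Q that] by auto
    show ?thesis
    proof (rule fork_at_mutateI[OF Q ab v])
      show "in_nbrs Q v \<noteq> {}" "out_nbrs Q v \<noteq> {}"
      proof -
        \<comment> \<open>While r is an out-neighbour of v, an in-neighbour is found by going from v
          through r to \<open>j0\<close>, which points back to v.\<close>
        have "sarrows Q j0 v > 0" using gt(1)[OF src j0] src by linarith
        then show "in_nbrs Q v \<noteq> {}" "out_nbrs Q v \<noteq> {}"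
          using src sarrows_pos_verts[OF Q] by (auto simp: in_nbrs_def out_nbrs_def)
      qed
      show "transp_on (in_nbrs Q v) ?lt"
        using jr by (intro rest) (auto simp: in_nbrs_def)
      show "transp_on (out_nbrs Q v) ?lt"
      proof (rule transp_onI)
        fix a b c assume *: "a \<in> out_nbrs Q v" "b \<in> out_nbrs Q v" "c \<in> out_nbrs Q v"
          "sarrows Q a b > 0" "sarrows Q b c > 0"
        then have "a = r \<or> sarrows Q a r > 0" "b = r \<or> sarrows Q b r > 0" "c = r \<or> sarrows Q c r > 0"
          using ir by (auto simp: out_nbrs_def)
        then have "a \<noteq> r" "b \<noteq> r" using * anti[of b r] anti[of c r] sarrows_refl[OF Q] by auto
        then show "sarrows Q a c > 0"
          using * \<open>a = r \<or> _\<close> transp_onD[OF trr, of a b c] by (auto simp: out_nbrs_def)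
      qed
      fix i j assume p: "sarrows Q j v > 0" "sarrows Q v i > 0"
      show "sarrows Q j i + sarrows Q j v * sarrows Q v i > sarrows Q j v \<and>
        sarrows Q j i + sarrows Q j v * sarrows Q v i > sarrows Q v i"
      \<comment> \<open>The only opposing case is the triangle v -> r -> j -> v, in which j -> v is
        the heaviest side.\<close>
      proof (cases "i = r \<and> sarrows Q r j > 0")
        case True
        then show ?thesis
          using gt[OF src, of j] diff_mult_gt[of "sarrows Q r j" "sarrows Q j v" "sarrows Q v r"]
            ge2[OF src] anti[of j r] by simp
      next
        case False
        then show ?thesis using concl[OF p] off[OF p] jr[OF p(1)] nr[of j] p sarrows_pos_verts[OF Q] by blast
      qed
    qed
  next
    \<comment> \<open>Dual to the previous case: r is now a source among the in-neighbours of v, and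
      the opposing triangle is r -> v -> i -> r with heaviest side v -> i.\<close>
    case tgt
    have ir: "i \<noteq> r" if "sarrows Q v i > 0" for i
      using tgt anti[of r v] that by auto
    have jr: "j = r \<or> sarrows Q r j > 0" if "sarrows Q j v > 0" for j
      using gt[OF _ tgt, of j] tgt anti[of v j] that nr[of j] sarrows_pos_verts[OF Q that] by auto
    show ?thesis
    proof (rule fork_at_mutateI[OF Q ab v])
      show "in_nbrs Q v \<noteq> {}" "out_nbrs Q v \<noteq> {}"
      proof -
        have "sarrows Q v i0 > 0" using gt(2)[OF i0 tgt] tgt by linarith
        then show "in_nbrs Q v \<noteq> {}" "out_nbrs Q v \<noteq> {}"
          using tgt sarrows_pos_verts[OF Q] by (auto simp: in_nbrs_def out_nbrs_def)
      qed
      show "transp_on (out_nbrs Q v) ?lt"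
        using ir by (intro rest) (auto simp: out_nbrs_def)
      show "transp_on (in_nbrs Q v) ?lt"
      proof (rule transp_onI)
        fix a b c assume *: "a \<in> in_nbrs Q v" "b \<in> in_nbrs Q v" "c \<in> in_nbrs Q v"
          "sarrows Q a b > 0" "sarrows Q b c > 0"
        then have **: "a = r \<or> sarrows Q r a > 0" "b = r \<or> sarrows Q r b > 0" "c = r \<or> sarrows Q r c > 0"
          using jr by (auto simp: in_nbrs_def)
        then have "c \<noteq> r" "b \<noteq> r" using * anti[of r b] anti[of r a] sarrows_refl[OF Q] by auto
        then show "sarrows Q a c > 0"
          using * ** transp_onD[OF trr, of a b c] by (auto simp: in_nbrs_def)
      qed
      fix i j assume p: "sarrows Q j v > 0" "sarrows Q v i > 0"
      show "sarrows Q j i + sarrows Q j v * sarrows Q v i > sarrows Q j v \<and>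
        sarrows Q j i + sarrows Q j v * sarrows Q v i > sarrows Q v i"
      proof (cases "j = r \<and> sarrows Q i r > 0")
        case True
        then show ?thesis
          using gt[OF _ tgt, of i] diff_mult_gt[of "sarrows Q i r" "sarrows Q v i" "sarrows Q r v"]
            ge2[OF tgt] anti[of r i] by (simp add: mult.commute)
      next
        case False
        then show ?thesis using concl[OF p] off[OF p] ir[OF p(2)] nr[of i] p sarrows_pos_verts[OF Q] by blast
      qed
    qed
  qed
qed

section \<open>The mutation class of an abundant acyclic quiver\<close>

text \<open>An abundant acyclic quiver is a linear order on its vertices together with weights.
  Mutation at a source or a sink rotates the order, so it preserves the weights and the induced
  cyclic order; the latter is recorded by the sum of signs around each triple.\<close>

definition rotations :: "'a pre_quiver \<Rightarrow> 'a pre_quiver set" where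
  "rotations P = {R. quiver R \<and> verts R = verts P \<and> abundant R \<and> acyclic_quiver R \<and>
     (\<forall>a b. \<bar>sarrows R a b\<bar> = \<bar>sarrows P a b\<bar>) \<and>
     (\<forall>a \<in> verts P. \<forall>b \<in> verts P. \<forall>c \<in> verts P.
        sgn (sarrows R a b) + sgn (sarrows R b c) + sgn (sarrows R c a) =
        sgn (sarrows P a b) + sgn (sarrows P b c) + sgn (sarrows P c a))}"

section \<open>Counting rotations by their sources\<close>

lemma ex_source:
  assumes R: "quiver R" and ab: "abundant R" and ac: "acyclic_quiver R" and ne: "verts R \<noteq> {}"
  shows "\<exists>s \<in> verts R. \<forall>a \<in> verts R - {s}. sarrows R s a > 0"
proof -
  let ?E = "{(i, j). arrows R i j > 0}"
  have "?E \<subseteq> verts R \<times> verts R" using R by (auto simp: quiver_def)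
  then have "finite ?E" using R by (meson finite_SigmaI finite_subset quiver_def)
  then have "wf ?E" using ac by (simp add: acyclic_quiver_def finite_acyclic_wf)
  then obtain s where s: "s \<in> verts R" "\<And>y. (y, s) \<in> ?E \<Longrightarrow> y \<notin> verts R"
    using ne by (meson ex_in_conv wfE_min)
  have "sarrows R s a > 0" if "a \<in> verts R - {s}" for a
    using verts_eq_nbrs[OF R ab s(1), of a] that s(2)[of a]
    by (auto simp: in_nbrs_def out_nbrs_def arrows_pos_iff)
  then show ?thesis using s(1) by blast
qed

text \<open>The source fixes the signs of all arrows at s; the cyclic sum of a triple s, a, b then
  fixes the sign between a and b, and the weights are shared.\<close>

lemma rotations_eq_of_source:
  assumes A: "A \<in> rotations P" and B: "B \<in> rotations P" and s: "s \<in> verts P"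
    and sA: "\<forall>a \<in> verts P - {s}. sarrows A s a > 0"
    and sB: "\<forall>a \<in> verts P - {s}. sarrows B s a > 0"
  shows "A = B"
proof -
  have QA: "quiver A" "verts A = verts P" and QB: "quiver B" "verts B = verts P"
    and abs: "\<bar>sarrows A a b\<bar> = \<bar>sarrows B a b\<bar>" for a b
    using A B by (auto simp: rotations_def)
  have tri: "sgn (sarrows A a b) + sgn (sarrows A b c) + sgn (sarrows A c a) =
     sgn (sarrows B a b) + sgn (sarrows B b c) + sgn (sarrows B c a)"
    if "a \<in> verts P" "b \<in> verts P" "c \<in> verts P" for a b c
    using A B that by (simp add: rotations_def)
  have s_eq: "sarrows A s a = sarrows B s a" if "a \<in> verts P" for a
    using abs[of s a] bspec[OF sA, of a] bspec[OF sB, of a] that sarrows_refl[OF QA(1)] sarrows_refl[OF QB(1)] by (cases "a = s") auto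
  have s_eq': "sarrows A a s = sarrows B a s" if "a \<in> verts P" for a
    using s_eq[OF that] sarrows_antisym[OF QA(1), of a s] sarrows_antisym[OF QB(1), of a s] by simp
  show ?thesis
  proof (rule quiver_eqI[OF QA(1) QB(1)])
    fix a b
    show "sarrows A a b = sarrows B a b"
    proof (cases "a \<in> verts P \<and> b \<in> verts P")
      case True
      then have "sgn (sarrows A a b) = sgn (sarrows B a b)"
        using tri[of s a b] s s_eq[of a] s_eq'[of b] by simp
      then show ?thesis using abs[of a b] by (metis mult_sgn_abs)
    next
      case False
      then show ?thesis using QA QB sarrows_outside by metis
    qed
  qed (simp add: QA QB)
qed

text \<open>Sending a rotation to its source is injective. Nonemptiness matters: the empty quiver
  has no source but is a rotation of itself.\<close>

lemma card_rotations:
  assumes P: "quiver P" and ne: "verts P \<noteq> {}"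
  shows "finite (rotations P) \<and> card (rotations P) \<le> card (verts P)"
proof -
  have fin: "finite (verts P)" using P by (simp add: quiver_def)
  have "\<forall>R \<in> rotations P. \<exists>s. s \<in> verts P \<and> (\<forall>a \<in> verts P - {s}. sarrows R s a > 0)"
    using ex_source ne unfolding rotations_def by fastforce
  then obtain f where
    f: "\<And>R. R \<in> rotations P \<Longrightarrow> f R \<in> verts P \<and> (\<forall>a \<in> verts P - {f R}. sarrows R (f R) a > 0)"
    by metis
  have "inj_on f (rotations P)"
    by (rule inj_onI) (metis f rotations_eq_of_source)
  moreover have "f ` rotations P \<subseteq> verts P" using f by blast
  ultimately show ?thesis using fin by (meson card_inj_on_le inj_on_finite)
qed

lemma mutate_rotations:
  assumes R: "R \<in> rotations P" and v: "v \<in> verts R"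
    and extremal: "in_nbrs R v = {} \<or> out_nbrs R v = {}"
  shows "mutate v R \<in> rotations P"
proof -
  let ?M = "mutate v R"
  have Q: "quiver R" and V: "verts R = verts P" and ab: "abundant R" and ac: "acyclic_quiver R"
    and wt: "\<And>a b. \<bar>sarrows R a b\<bar> = \<bar>sarrows P a b\<bar>"
    and tri: "\<And>a b c. a \<in> verts P \<Longrightarrow> b \<in> verts P \<Longrightarrow> c \<in> verts P \<Longrightarrow>
        sgn (sarrows R a b) + sgn (sarrows R b c) + sgn (sarrows R c a) =
        sgn (sarrows P a b) + sgn (sarrows P b c) + sgn (sarrows P c a)"
    using R by (auto simp: rotations_def)
  note anti = sarrows_antisym[OF Q]
  have M: "quiver ?M" by (rule quiver_mutate[OF Q v])
  \<comment> \<open>At a source or sink each product in the mutation formula has a zero factor, so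
    mutation merely reverses the arrows at v.\<close>
  have "(\<forall>a. \<not> sarrows R a v > 0) \<or> (\<forall>a. \<not> sarrows R v a > 0)"
    using extremal sarrows_pos_verts[OF Q] by (auto simp: in_nbrs_def out_nbrs_def)
  then have sM: "sarrows ?M a b = (if v \<in> {a, b} then - sarrows R a b else sarrows R a b)" for a b
    by (elim disjE) (simp_all add: sarrows_mutate[OF Q] mutated_sarrows_def not_less max_absorb2)
  have abM: "abundant ?M" using ab by (simp add: abundant_def sM)
  have extv: "(\<forall>a \<in> verts P - {v}. sarrows R v a > 0) \<or> (\<forall>a \<in> verts P - {v}. sarrows R a v > 0)"
    using extremal verts_eq_nbrs[OF Q ab v] V by (auto simp: in_nbrs_def out_nbrs_def)
  \<comment> \<open>The two signs that v contributes to the cyclic sum of a triple cancel, and still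
    do after the reversal.\<close>
  have sg: "sgn (sarrows R v a) = - sgn (sarrows R b v)" if "a \<in> verts P - {v}" "b \<in> verts P - {v}" for a b
    using extv
  proof
    assume "\<forall>a \<in> verts P - {v}. sarrows R v a > 0"
    then have "sarrows R v a > 0" "sarrows R v b > 0" using that by blast+
    then show ?thesis using anti[of v b] by simp
  next
    assume "\<forall>a \<in> verts P - {v}. sarrows R a v > 0"
    then have "sarrows R a v > 0" "sarrows R b v > 0" using that by blast+
    then show ?thesis using anti[of a v] by simp
  qed
  have sv: "sarrows ?M v a = - sarrows R v a" "sarrows ?M a v = sarrows R v a" for a
    using anti[of v a] by (auto simp: sM)
  have same: "sarrows R v a > 0 \<longleftrightarrow> sarrows R v b > 0" "sarrows R v a < 0 \<longleftrightarrow> sarrows R v b < 0"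
    if "a \<in> verts P - {v}" "b \<in> verts P - {v}" for a b
    using sg[OF that] anti[of v b] by (auto simp: sgn_if split: if_splits)
  have tr: "transp_on (verts R) (\<lambda>a b. sarrows R a b > 0)"
    using acyclic_quiver_iff[OF Q ab] ac by simp
  have "transp_on (verts ?M) (\<lambda>a b. sarrows ?M a b > 0)"
  proof (rule transp_onI)
    fix a b c
    assume abc: "a \<in> verts ?M" "b \<in> verts ?M" "c \<in> verts ?M"
      and p: "sarrows ?M a b > 0" "sarrows ?M b c > 0"
    have neq: "a \<noteq> b" "b \<noteq> c" using p sarrows_refl[OF M] by auto
    \<comment> \<open>After mutation v is still a source or a sink, so it cannot be the middle of a
      path.\<close>
    have bv: "b \<noteq> v"
      using p neq same(1)[of a c] abc V by (auto simp: sv)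
    have ca: "c \<noteq> a" using p sarrows_antisym[OF M, of a b] by auto
    consider "a = v" | "c = v" | "a \<noteq> v" "c \<noteq> v" by blast
    then show "sarrows ?M a c > 0"
    proof cases
      case 1
      then show ?thesis using p same(2)[of b c] abc V neq ca by (auto simp: sv)
    next
      case 2
      then show ?thesis using p same(1)[of a b] abc V neq ca by (auto simp: sv)
    next
      case 3
      then show ?thesis using p bv transp_onD[OF tr, of a b c] abc by (auto simp: sM)
    qed
  qed
  then have acM: "acyclic_quiver ?M" using acyclic_quiver_iff[OF M abM] by simp
  have "sgn (sarrows ?M a b) + sgn (sarrows ?M b c) + sgn (sarrows ?M c a) =
        sgn (sarrows P a b) + sgn (sarrows P b c) + sgn (sarrows P c a)"
    if abc: "a \<in> verts P" "b \<in> verts P" "c \<in> verts P" for a b c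
  proof -
    have "sgn (sarrows ?M a b) + sgn (sarrows ?M b c) + sgn (sarrows ?M c a) =
        sgn (sarrows R a b) + sgn (sarrows R b c) + sgn (sarrows R c a)"
      using sg[of a b] sg[of b a] sg[of a c] sg[of c a] sg[of b c] sg[of c b] abc
        anti[of v a] anti[of v b] anti[of v c] sarrows_refl[OF Q, of v]
      by (auto simp: sM)
    then show ?thesis using tri[OF abc] by simp
  qed
  then show ?thesis
    using M V abM acM wt by (auto simp: rotations_def sM)
qed

text \<open>In the second rule, mutating at the point of return leads back towards a rotation of
  \<open>P\<close>.\<close>

inductive tame :: "'a pre_quiver \<Rightarrow> 'a pre_quiver \<Rightarrow> bool" for P where
  rotation: "R \<in> rotations P \<Longrightarrow> tame P R"
| fork: "quiver R \<Longrightarrow> fork_at R r \<Longrightarrow> tame P (mutate r R) \<Longrightarrow> tame P R"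

text \<open>Mutation at v either creates a fork with point of return v, from which mutating at v
  returns to R, or is one of two exceptions: a rotation is mutated at a source or sink, giving a
  rotation, or a fork at its recorded point of return, giving its tame predecessor.\<close>

lemma tame_mutate:
  assumes R: "tame P R" and v: "v \<in> verts R"
  shows "tame P (mutate v R)"
proof -
  have undo: "tame P (mutate v R)" if Q: "quiver R" and f: "fork_at (mutate v R) v"
    using tame.fork[OF quiver_mutate[OF Q v] f] mutate_mutate[OF Q v] R by simp
  show ?thesis
    using R
  proof cases
    case rotation
    then have "quiver R" "abundant R" "acyclic_quiver R" by (auto simp: rotations_def)
    then show ?thesis
      using undo fork_at_mutate_acyclic[of R v] v mutate_rotations[OF rotation v] tame.rotation by blast
  next
    case (fork r)
    then show ?thesis using undo fork_at_mutate_fork_at[OF fork(1,2) v] by blast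
  qed
qed

text \<open>The whole class is tame, and every tame quiver obtained by the second rule is a fork; a
  non-fork must come from the first.\<close>

lemma forkless_part_acyclic:
  assumes P: "quiver P" "abundant P" "acyclic_quiver P"
  shows "forkless_part P \<subseteq> rotations P"
proof
  fix R assume "R \<in> forkless_part P"
  then have R: "R \<in> mutation_class P" and nf: "\<not> fork R" by (auto simp: forkless_part_def)
  have "P \<in> rotations P" using P by (simp add: rotations_def)
  from R have "tame P R"
    by induction (auto intro: tame.rotation tame_mutate \<open>P \<in> rotations P\<close>)
  then show "R \<in> rotations P"
  proof cases
    case (fork r)
    then show ?thesis using nf fork_at_imp_fork[of R r] by simp
  qed
qed

section \<open>Forkless parts of full subquivers\<close>

lemma forkless_part_mutation_class:
  assumes "P \<in> mutation_class Q" and "quiver Q"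
  shows "forkless_part P = forkless_part Q"
  using assms mutation_class_trans mutation_class_sym unfolding forkless_part_def by blast

theorem theorem1p1:
  fixes Q :: "'a pre_quiver" and S :: "'a set"
  assumes "quiver Q"
    and "finite (forkless_part Q)"
    and "S \<subseteq> verts Q" and "S \<noteq> {}"
  shows "finite (forkless_part (full_subquiver Q S)) \<and>
         card (forkless_part (full_subquiver Q S)) \<le> max (card (forkless_part Q)) (card S)"
proof -
  let ?Q' = "full_subquiver Q S"
  have Q': "quiver ?Q'" by (rule quiver_full_subquiver[OF assms(1,3)])
  show ?thesis
  proof (cases "\<exists>P \<in> mutation_class ?Q'. abundant P \<and> acyclic_quiver P")
    case True
    then obtain P where P: "P \<in> mutation_class ?Q'" "abundant P" "acyclic_quiver P" by blast
    have QP: "quiver P" "verts P = S" using quiver_mutation_class[OF P(1) Q'] by auto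
    have "forkless_part ?Q' \<subseteq> rotations P"
      using forkless_part_acyclic[OF QP(1) P(2,3)] forkless_part_mutation_class[OF P(1) Q'] by simp
    moreover have "finite (rotations P)" "card (rotations P) \<le> card S"
      using card_rotations[OF QP(1)] QP(2) assms(4) by auto
    ultimately show ?thesis by (meson card_mono finite_subset le_max_iff_disj order_trans)
  next
    case False
    \<comment> \<open>An image of \<open>forkless_part Q\<close> covers the non-forks of the
      subquiver, which gives both finiteness and the bound.\<close>
    have "forkless_part ?Q' \<subseteq> (\<lambda>L. full_subquiver L S) ` forkless_part Q"
    proof
      fix R assume "R \<in> forkless_part ?Q'"
      then have R: "R \<in> mutation_class ?Q'" "\<not> fork R" by (auto simp: forkless_part_def)
      obtain L where L: "L \<in> mutation_class Q" "full_subquiver L S = R"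
        using mutation_class_full_subquiver_lift[OF R(1) assms(1,3)] by blast
      have "quiver L" "verts L = verts Q" using quiver_mutation_class[OF L(1) assms(1)] by auto
      \<comment> \<open>A fork L would restrict either to a fork, contrary to the choice of R, or to
        an abundant acyclic quiver, excluded in this case.\<close>
      then have "\<not> fork L" using full_subquiver_fork[of L S] L(2) R False assms(3) by auto
      then show "R \<in> (\<lambda>L. full_subquiver L S) ` forkless_part Q"
        using L by (auto simp: forkless_part_def)
    qed
    then have "finite (forkless_part ?Q')" "card (forkless_part ?Q') \<le> card (forkless_part Q)"
      using assms(2) surj_card_le by (auto intro: finite_surj)
    then show ?thesis by simp
  qed
qed

end
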